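(* Let $\alpha>0$, $\beta>0$, $\gamma>1$ and $\lambda\in\mathbb{R}$. Then for all $s\in\mathbb{C}$ with $\mathrm{Re}\,s>0$, $$\mathcal{L}\left(\frac{\partial}{\partial\alpha}\left[t^{\beta-1}F_{\alpha,\beta}^{(\gamma)}(\lambda t^{\alpha})\right]\right)(s)=-\frac{1}{s^{\beta}}\sum_{k=0}^{\infty}k\left(\frac{\lambda}{s^{\alpha}}\right)^k\frac{\ln s+(\gamma-1)\psi(\alpha k+\beta)}{[\Gamma(\alpha k+\beta)]^{\gamma-1}},$$ $$\mathcal{L}\left(\frac{\partial}{\partial\beta}\left[t^{\beta-1}F_{\alpha,\beta}^{(\gamma)}(\lambda t^{\alpha})\right]\right)(s)=-\frac{1}{s^{\beta}}\sum_{k=0}^{\infty}\left(\frac{\lambda}{s^{\alpha}}\right)^k\frac{\ln s+(\gamma-1)\psi(\alpha k+\beta)}{[\Gamma(\alpha k+\beta)]^{\gamma-1}},$$ $$\mathcal{L}\left(\frac{\partial}{\partial\gamma}\left[t^{\beta-1}F_{\alpha,\beta}^{(\gamma)}(\lambda t^{\alpha})\right]\right)(s)=-\frac{1}{s^{\beta}}\sum_{k=0}^{\infty}\left(\frac{\lambda}{s^{\alpha}}\right)^k\frac{\ln\Gamma(\alpha k+\beta)}{[\Gamma(\alpha k+\beta)]^{\gamma-1}}.$$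
   Context: $F_{\alpha,\beta}^{(\gamma)}(z)=\sum_{k=0}^{\infty}\frac{z^k}{[\Gamma(\alpha k+\beta)]^{\gamma}}$ is the Le Roy type function. $\psi=\Gamma'/\Gamma$ is the digamma function. The convention $0^0=1$ is used. The Laplace transform acts in the variable $t>0$: $\mathcal{L}(f(t))(s)=\int_0^\infty e^{-st}f(t)\,dt$. Powers of $s$ and $\ln s$ are principal branches. *)

theory Defs
  imports "HOL-Analysis.Analysis"
begin

text \<open>
  The Le Roy type function \<open>F\<^sub>\<alpha>\<^sub>,\<^sub>\<beta>\<^sup>(\<^sup>\<gamma>\<^sup>)(z)\<close>. The definition is polymorphic in the
  argument \<open>z\<close>, so it covers real and complex \<open>z\<close>. For \<open>\<alpha>, \<beta> > 0\<close> the values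
  \<open>Gamma (\<alpha> k + \<beta>)\<close> are positive reals, so the real \<open>powr\<close> is the ordinary power.
\<close>
definition le_roy ::
  "real \<Rightarrow> real \<Rightarrow> real \<Rightarrow> 'a \<Rightarrow> 'a :: {real_normed_field, banach}" where
  "le_roy \<alpha> \<beta> \<gamma> z = (\<Sum>k. z ^ k / of_real (Gamma (\<alpha> * real k + \<beta>) powr \<gamma>))"

text \<open>
  The argument \<open>\<lambda> t\<^sup>\<alpha>\<close> and the factor \<open>t\<^sup>\<beta>\<^sup>-\<^sup>1\<close> depend on the same parameters as the
  Le Roy function itself, so partial derivatives of this function in \<open>\<alpha>\<close> and \<open>\<beta>\<close> act on
  every occurrence.
\<close>
definition le_roy_kernel :: "real \<Rightarrow> real \<Rightarrow> real \<Rightarrow> real \<Rightarrow> real \<Rightarrow> real" where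
  "le_roy_kernel \<alpha> \<beta> \<gamma> l t = t powr (\<beta> - 1) * le_roy \<alpha> \<beta> \<gamma> (l * t powr \<alpha>)"

text \<open>
  The Bochner integral of a non-integrable function is 0 by convention, so an equation about
  \<open>laplace\<close> is only meaningful together with \<open>laplace_converges\<close>.
\<close>
definition laplace_converges :: "(real \<Rightarrow> real) \<Rightarrow> complex \<Rightarrow> bool" where
  "laplace_converges f s \<longleftrightarrow>
     set_integrable lborel {0<..} (\<lambda>t. exp (- (s * of_real t)) * of_real (f t))"

definition laplace :: "(real \<Rightarrow> real) \<Rightarrow> complex \<Rightarrow> complex" where
  "laplace f s = (LINT t:{0<..}|lborel. exp (- (s * of_real t)) * of_real (f t))"

end

theory Submission
  imports Defs
begin

text \<open>
  Write \<open>x\<^sub>k = \<alpha> k + \<beta>\<close>. The kernel is \<open>\<Sum>k. \<lambda>\<^sup>k t\<^bsup>x\<^sub>k - 1\<^esup> \<Gamma>(x\<^sub>k)\<^bsup>-\<gamma>\<^esup>\<close>. The three partial derivatives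
  are derivatives along straight lines \<open>(\<alpha> + u h, \<beta> + w h, \<gamma> + v h)\<close> in parameter space, so one
  computation for arbitrary \<open>u, w, v\<close> covers them all. With \<open>\<omega>\<^sub>k = u k + w\<close>, differentiating term by
  term at \<open>h = 0\<close> multiplies the \<open>k\<close>-th term by
  \<open>\<omega>\<^sub>k (ln t - \<gamma> \<psi>(x\<^sub>k)) - v ln \<Gamma>(x\<^sub>k)\<close>.

  The Laplace transform of \<open>t\<^bsup>x-1\<^esup>\<close> is \<open>\<Gamma>(x) s\<^bsup>-x\<^esup>\<close>, and differentiating in \<open>x\<close> gives
  \<open>\<Gamma>(x) (\<psi>(x) - ln s) s\<^bsup>-x\<^esup>\<close> for \<open>t\<^bsup>x-1\<^esup> ln t\<close>. Transforming term by term, the summand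
  \<open>\<psi>(x\<^sub>k)\<close> from the logarithm combines with \<open>-\<gamma> \<psi>(x\<^sub>k)\<close> to \<open>-(\<gamma> - 1) \<psi>(x\<^sub>k)\<close>, one factor \<open>\<Gamma>(x\<^sub>k)\<close>
  cancels, and what remains is minus \<open>s\<^bsup>-\<beta>\<^esup>\<close> times the series in the theorem.

  Both interchanges are justified by one growth fact: \<open>\<Gamma>(x)\<close> eventually exceeds \<open>M\<^sup>x\<close> for every \<open>M\<close>,
  so a positive power of \<open>1/\<Gamma>(x\<^sub>k)\<close> makes every exponentially bounded coefficient sequence summable
  (\<open>exp_bounded_Gamma_powr_majorant\<close>). The powers of \<open>t\<close> and of \<open>\<lambda>\<close>, the polynomially bounded
  \<open>\<psi>(x\<^sub>k)\<close> and \<open>ln \<Gamma>(x\<^sub>k)\<close>, and the weights \<open>\<omega>\<^sub>k\<close> are all exponentially bounded. For the derivative the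
  available power of \<open>1/\<Gamma>(x\<^sub>k)\<close> is at least \<open>\<gamma> / 2\<close>; after integration over \<open>t\<close> only the power
  \<open>\<gamma> - 1\<close> is left, which is where \<open>\<gamma> > 1\<close> enters.
\<close>

section \<open>Exponentially bounded sequences\<close>

lemma self_le_exp: "(x::real) \<le> exp x"
  by (rule order_trans[OF _ exp_ge_add_one_self]) simp

text \<open>
  The exponent is a multiple of \<open>k + 1\<close> rather than of \<open>k\<close> so that a single rate also absorbs
  constant factors; closure under sums and products then needs no case distinctions.
\<close>
definition exp_bounded :: "(nat \<Rightarrow> real) \<Rightarrow> bool" where
  "exp_bounded f \<longleftrightarrow> (\<exists>A. \<forall>k. \<bar>f k\<bar> \<le> exp (A * (real k + 1)))"

lemma exp_boundedE:
  assumes "exp_bounded f"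
  obtains A where "A \<ge> 0" "\<And>k. \<bar>f k\<bar> \<le> exp (A * (real k + 1))"
proof -
  from assms obtain A where A: "\<And>k. \<bar>f k\<bar> \<le> exp (A * (real k + 1))"
    unfolding exp_bounded_def by blast
  have "\<bar>f k\<bar> \<le> exp (max 0 A * (real k + 1))" for k
  proof -
    have "A * (real k + 1) \<le> max 0 A * (real k + 1)" by (intro mult_right_mono) auto
    thus ?thesis using A[of k] by (meson exp_le_cancel_iff order_trans)
  qed
  thus thesis using that[of "max 0 A"] by simp
qed

lemma exp_bounded_mono:
  assumes "exp_bounded g" "\<And>k. \<bar>f k\<bar> \<le> \<bar>g k\<bar>"
  shows "exp_bounded f"
  using assms unfolding exp_bounded_def by (meson order_trans)

lemma exp_bounded_exp_affine: "exp_bounded (\<lambda>k. exp (p * real k + q))"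
proof -
  have "p * real k + q \<le> (\<bar>p\<bar> + \<bar>q\<bar>) * (real k + 1)" for k
  proof -
    have "p * real k \<le> \<bar>p\<bar> * real k" by (intro mult_right_mono) auto
    moreover have "0 \<le> \<bar>q\<bar> * real k" by simp
    ultimately show ?thesis unfolding ring_distribs by linarith
  qed
  thus ?thesis unfolding exp_bounded_def by auto
qed

lemma exp_bounded_mult:
  assumes "exp_bounded f" "exp_bounded g"
  shows "exp_bounded (\<lambda>k. f k * g k)"
proof -
  obtain A B where A: "\<And>k. \<bar>f k\<bar> \<le> exp (A * (real k + 1))" and B: "\<And>k. \<bar>g k\<bar> \<le> exp (B * (real k + 1))"
    using assms by (meson exp_boundedE)
  have "\<bar>f k * g k\<bar> \<le> exp ((A + B) * (real k + 1))" for k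
    using mult_mono[OF A[of k] B[of k]] by (simp add: abs_mult exp_add ring_distribs mult_ac)
  thus ?thesis unfolding exp_bounded_def by blast
qed

lemma exp_bounded_add:
  assumes "exp_bounded f" "exp_bounded g"
  shows "exp_bounded (\<lambda>k. f k + g k)"
proof -
  obtain A B where A: "A \<ge> 0" "\<And>k. \<bar>f k\<bar> \<le> exp (A * (real k + 1))"
    and B: "B \<ge> 0" "\<And>k. \<bar>g k\<bar> \<le> exp (B * (real k + 1))"
    using assms by (meson exp_boundedE)
  have "\<bar>f k + g k\<bar> \<le> exp ((A + B + 1) * (real k + 1))" for k
  proof -
    have "exp (A * (real k + 1)) \<le> exp ((A + B) * (real k + 1))"
      and "exp (B * (real k + 1)) \<le> exp ((A + B) * (real k + 1))"
      using A(1) B(1) by (simp_all add: mult_right_mono)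
    hence "\<bar>f k + g k\<bar> \<le> 2 * exp ((A + B) * (real k + 1))"
      using A(2)[of k] B(2)[of k] by linarith
    also have "2 \<le> exp (real k + 1)" using exp_ge_add_one_self[of "real k + 1"] by simp
    finally show ?thesis
      by (simp add: ring_distribs exp_add mult_ac)
  qed
  thus ?thesis unfolding exp_bounded_def by blast
qed

lemma exp_bounded_const: "exp_bounded (\<lambda>k. c)"
proof (rule exp_bounded_mono[OF exp_bounded_exp_affine[of 0 "\<bar>c\<bar>"]])
  show "\<bar>c\<bar> \<le> \<bar>exp (0 * real k + \<bar>c\<bar>)\<bar>" for k
    using self_le_exp[of "\<bar>c\<bar>"] by simp
qed

lemma exp_bounded_minus: "exp_bounded f \<Longrightarrow> exp_bounded (\<lambda>k. - f k)"
  and exp_bounded_abs: "exp_bounded f \<Longrightarrow> exp_bounded (\<lambda>k. \<bar>f k\<bar>)"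
  by (simp_all add: exp_bounded_def)

lemma exp_bounded_diff:
  "exp_bounded f \<Longrightarrow> exp_bounded g \<Longrightarrow> exp_bounded (\<lambda>k. f k - g k)"
  using exp_bounded_add[of f "\<lambda>k. - g k"] by (simp add: exp_bounded_minus)

lemma exp_bounded_real: "exp_bounded real"
proof (rule exp_bounded_mono[OF exp_bounded_exp_affine[of 1 0]])
  show "\<bar>real k\<bar> \<le> \<bar>exp (1 * real k + 0)\<bar>" for k
    using self_le_exp[of "real k"] by simp
qed

lemma exp_bounded_power: "exp_bounded (\<lambda>k. c ^ k)"
proof (rule exp_bounded_mono[OF exp_bounded_exp_affine[of "\<bar>c\<bar>" 0]])
  fix k
  have "\<bar>c\<bar> ^ k \<le> exp \<bar>c\<bar> ^ k"
    using self_le_exp[of "\<bar>c\<bar>"] by (intro power_mono) auto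
  thus "\<bar>c ^ k\<bar> \<le> \<bar>exp (\<bar>c\<bar> * real k + 0)\<bar>"
    by (simp add: power_abs exp_of_nat_mult[symmetric] mult.commute)
qed

lemma exp_bounded_powr: "exp_bounded (\<lambda>k. t powr (p * real k + q))"
proof (cases "t = 0")
  case False
  thus ?thesis
    using exp_bounded_exp_affine[of "p * ln t" "q * ln t"] by (simp add: powr_def ring_distribs mult_ac)
qed (simp add: exp_bounded_const)

lemmas exp_bounded_intros =
  exp_bounded_mult exp_bounded_add exp_bounded_diff exp_bounded_minus exp_bounded_abs
  exp_bounded_const exp_bounded_real exp_bounded_power exp_bounded_powr exp_bounded_exp_affine

lemma exp_bounded_affine: "exp_bounded (\<lambda>k. p * real k + q)"
  by (intro exp_bounded_intros)

section \<open>The Gamma integral and the growth of Gamma\<close>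

text \<open>
  This is Euler's integral after the substitution \<open>t \<mapsto> \<sigma> t\<close>. Besides serving as the real case of
  the Laplace transform, it dominates all later integrals.
\<close>
lemma laplace_powr_real:
  fixes x \<sigma> :: real
  assumes "x > 0" "\<sigma> > 0"
  shows "has_bochner_integral lborel
           (\<lambda>t. indicator {0<..} t *\<^sub>R (exp (- (\<sigma> * t)) * t powr (x - 1))) (Gamma x / \<sigma> powr x)"
proof -
  let ?g = "\<lambda>t::real. indicator {0..} t * t powr (x - 1) / exp t"
  have "has_bochner_integral lborel ?g (Gamma x)"
  proof (rule has_bochner_integral_nn_integral)
    show "integral\<^sup>N lborel (\<lambda>t. ennreal (?g t)) = ennreal (Gamma x)"
      using Gamma_conv_nn_integral_real[OF assms(1)] by simp
  qed (use assms in \<open>auto intro!: AE_I2\<close>)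
  hence "has_bochner_integral lborel (\<lambda>t. ?g (0 + \<sigma> * t)) (Gamma x /\<^sub>R \<bar>\<sigma>\<bar>)"
    by (subst (asm) lborel_has_bochner_integral_real_affine_iff[of \<sigma> _ _ 0]) (use assms in auto)
  hence "has_bochner_integral lborel (\<lambda>t. \<sigma> powr (1 - x) * ?g (0 + \<sigma> * t))
           (\<sigma> powr (1 - x) * (Gamma x /\<^sub>R \<bar>\<sigma>\<bar>))"
    by (rule has_bochner_integral_mult_right)
  also have "(\<lambda>t. \<sigma> powr (1 - x) * ?g (0 + \<sigma> * t)) =
             (\<lambda>t. indicator {0<..} t *\<^sub>R (exp (- (\<sigma> * t)) * t powr (x - 1)))"
  proof
    fix t :: real
    show "\<sigma> powr (1 - x) * ?g (0 + \<sigma> * t) = indicator {0<..} t *\<^sub>R (exp (- (\<sigma> * t)) * t powr (x - 1))"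
    proof (cases "t > 0")
      case True
      have "\<sigma> powr (1 - x) * \<sigma> powr (x - 1) = 1"
        using assms by (simp flip: powr_add)
      hence "\<sigma> powr (1 - x) * (\<sigma> * t) powr (x - 1) = t powr (x - 1)"
        using True assms by (simp add: powr_mult flip: mult.assoc)
      thus ?thesis using True assms by (simp add: exp_minus field_simps)
    next
      case False
      thus ?thesis using assms by (auto simp: indicator_def zero_le_mult_iff)
    qed
  qed
  also have "\<sigma> powr (1 - x) * (Gamma x /\<^sub>R \<bar>\<sigma>\<bar>) = Gamma x / \<sigma> powr x"
    using assms by (simp add: powr_diff field_simps)
  finally show ?thesis .
qed

text \<open>
  Restrict Euler's integral to the interval \<open>[M, M + 1]\<close> and estimate \<open>t\<^bsup>x-1\<^esup> = t\<^sup>x / t\<close> there.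
\<close>
lemma Gamma_real_ge_exponential:
  fixes M x :: real
  assumes "M > 0" "x > 0"
  shows "Gamma x \<ge> M powr x * exp (- (M + 1)) / (M + 1)"
proof -
  let ?g = "\<lambda>t. exp (- t) * t powr (x - 1)"
  have G: "has_bochner_integral lborel (\<lambda>t. indicator {0<..} t *\<^sub>R ?g t) (Gamma x)"
    using laplace_powr_real[of x 1] assms by simp
  let ?c = "M powr x * exp (- (M + 1)) / (M + 1)"
  have "has_bochner_integral lborel (\<lambda>t. indicator {M..M+1} t *\<^sub>R ?c) (measure lborel {M..M+1} *\<^sub>R ?c)"
    by (rule has_bochner_integral_indicator) auto
  hence H: "has_bochner_integral lborel (\<lambda>t. indicator {M..M+1} t *\<^sub>R ?c) ?c" by simp
  have "integral\<^sup>L lborel (\<lambda>t. indicator {M..M+1} t *\<^sub>R ?c) \<le> integral\<^sup>L lborel (\<lambda>t. indicator {0<..} t *\<^sub>R ?g t)"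
  proof (rule integral_mono)
    fix t :: real
    show "indicator {M..M+1} t *\<^sub>R ?c \<le> indicator {0<..} t *\<^sub>R ?g t"
    proof (cases "t \<in> {M..M+1}")
      case True
      have "M powr x * exp (- (M + 1)) / (M + 1) \<le> t powr x * exp (- t) / t"
        using True assms by (intro frac_le mult_mono powr_mono2) auto
      also have "\<dots> = ?g t" using True assms by (simp add: powr_diff)
      finally show ?thesis using True assms by simp
    qed (auto simp: indicator_def)
  qed (use H G in \<open>auto simp: has_bochner_integral_iff\<close>)
  thus ?thesis using H G by (simp add: has_bochner_integral_iff)
qed

text \<open>
  The rate \<open>L\<close> is arbitrary and \<open>K\<close> is uniform in the exponent \<open>c\<close>; the uniformity is what allows
  differentiation with respect to \<open>\<gamma>\<close>.
\<close>
lemma Gamma_powr_minus_le_exponential: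
  fixes c1 c2 L :: real
  assumes "c1 > 0"
  obtains K where "K > 0" "\<And>y c. y > 0 \<Longrightarrow> c1 \<le> c \<Longrightarrow> c \<le> c2 \<Longrightarrow> Gamma y powr (- c) \<le> K * exp (- (L * y))"
proof -
  \<comment> \<open>With this \<open>M\<close> the factor \<open>M\<^bsup>-cy\<^esup>\<close> is at most \<open>exp (- L y)\<close> for every \<open>c \<ge> c1\<close>.\<close>
  define M where "M = exp (max 0 L / c1)"
  define q where "q = exp (- (M + 1)) / (M + 1)"
  have M: "M \<ge> 1" using assms by (simp add: M_def)
  have "exp (- (M + 1)) \<le> 1" by (subst exp_le_one_iff) (use M in linarith)
  also have "1 \<le> M + 1" using M by linarith
  finally have "exp (- (M + 1)) \<le> M + 1" .
  hence q: "q > 0" "q \<le> 1"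
    using M by (simp_all only: q_def divide_le_eq_1_pos zero_less_divide_iff) auto
  show thesis
  proof (rule that[of "q powr (- c2)"])
    show "q powr (- c2) > 0" using q by simp
    fix y c :: real assume y: "y > 0" and c: "c1 \<le> c" "c \<le> c2"
    have "Gamma y \<ge> M powr y * q"
      using Gamma_real_ge_exponential[of M y] M y by (simp add: q_def)
    hence "Gamma y powr (-c) \<le> (M powr y * q) powr (-c)"
      using M q c assms y by (intro powr_mono2') auto
    also have "\<dots> = q powr (-c) * M powr (- (c * y))"
      using M q by (simp add: powr_mult powr_powr mult_ac)
    also have "\<dots> \<le> q powr (-c2) * exp (- (L * y))"
    proof (intro mult_mono)
      show "q powr (-c) \<le> q powr (-c2)" using q c by (intro powr_mono') auto
      have "L * y \<le> max 0 L * y" using y by (intro mult_right_mono) auto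
      also have "\<dots> = (max 0 L / c1) * (c1 * y)" using assms by simp
      also have "\<dots> \<le> (max 0 L / c1) * (c * y)"
        using assms c y by (intro mult_left_mono mult_right_mono) auto
      finally show "M powr (- (c * y)) \<le> exp (- (L * y))"
        by (simp add: M_def powr_def mult_ac)
    qed auto
    finally show "Gamma y powr (-c) \<le> q powr (-c2) * exp (- (L * y))" .
  qed
qed

text \<open>
  The single source of summability. The majorant is uniform in the argument \<open>y\<close> above the line
  \<open>a k + b\<close> and in the exponent \<open>c\<close>, as the Weierstrass test for the differentiated series requires.
\<close>
lemma exp_bounded_Gamma_powr_majorant:
  fixes a b c1 c2 :: real
  assumes "exp_bounded F" "a > 0" "b > 0" "c1 > 0"
  obtains M where "summable M"
    "\<And>k y c. y \<ge> a * real k + b \<Longrightarrow> c1 \<le> c \<Longrightarrow> c \<le> c2 \<Longrightarrow> \<bar>F k\<bar> * Gamma y powr (- c) \<le> M k"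
proof -
  obtain A where A: "A \<ge> 0" "\<And>k. \<bar>F k\<bar> \<le> exp (A * (real k + 1))"
    using exp_boundedE[OF assms(1)] by blast
  \<comment> \<open>The decay \<open>exp (- L a k)\<close> beats the growth \<open>exp (A k)\<close> by a factor \<open>exp (- k)\<close>.\<close>
  define L where "L = (A + 1) / a"
  have L: "L \<ge> 0" using A assms by (simp add: L_def)
  obtain K where K: "K > 0" 
    "\<And>y c. y > 0 \<Longrightarrow> c1 \<le> c \<Longrightarrow> c \<le> c2 \<Longrightarrow> Gamma y powr (- c) \<le> K * exp (- (L * y))"
    using Gamma_powr_minus_le_exponential[OF assms(4), of c2 L] by blast
  show thesis
  proof (rule that[of "\<lambda>k. (K * exp A) * exp (-1) ^ k"])
    show "summable (\<lambda>k. (K * exp A) * exp (-1) ^ k)"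
      by (intro summable_mult summable_geometric) simp
    fix k :: nat and y c :: real
    assume y: "y \<ge> a * real k + b" and c: "c1 \<le> c" "c \<le> c2"
    have y0: "y > 0" using y assms by (smt (verit) mult_nonneg_nonneg of_nat_0_le_iff)
    have "(A + 1) * real k = L * (a * real k)" using assms by (simp add: L_def)
    also have "\<dots> \<le> L * y" using L y assms by (intro mult_left_mono) auto
    finally have le: "A * (real k + 1) - L * y \<le> A - real k" by (simp add: algebra_simps)
    have "\<bar>F k\<bar> * Gamma y powr (-c) \<le> exp (A * (real k + 1)) * (K * exp (- (L * y)))"
      using A(2)[of k] K(2)[OF y0 c] by (intro mult_mono) auto
    also have "\<dots> = K * exp (A * (real k + 1) - L * y)" by (simp add: exp_diff exp_minus field_simps)
    also have "\<dots> \<le> K * exp (A - real k)" using K le by simp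
    also have "\<dots> = (K * exp A) * exp (-1) ^ k"
      by (simp add: exp_diff exp_minus exp_of_nat_mult[symmetric] power_inverse field_simps)
    finally show "\<bar>F k\<bar> * Gamma y powr (-c) \<le> (K * exp A) * exp (-1) ^ k" .
  qed
qed

lemma summable_exp_bounded_Gamma_powr:
  assumes "exp_bounded F" "a > 0" "b > 0" "c > 0"
  shows "summable (\<lambda>k. \<bar>F k\<bar> * Gamma (a * real k + b) powr (- c))"
proof -
  obtain M where M: "summable M" "\<And>k y c'. y \<ge> a * real k + b \<Longrightarrow> c \<le> c' \<Longrightarrow> c' \<le> c \<Longrightarrow> \<bar>F k\<bar> * Gamma y powr (- c') \<le> M k"
    using exp_bounded_Gamma_powr_majorant[OF assms, of c] by blast
  show ?thesis
    by (rule summable_comparison_test'[OF M(1)]) (use M(2) in auto)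
qed


text \<open>
  \<open>\<psi>\<close> is increasing, so it is bounded below by its value at \<open>b\<close>, and above by its value at the next
  integer, which is a harmonic number minus a constant. The mean value theorem passes this on to
  \<open>ln \<Gamma>\<close>. Much sharper bounds hold, but any polynomial will do here.
\<close>
lemma Digamma_ln_Gamma_real_bounds:
  fixes b :: real
  assumes "b > 0"
  obtains C where "C \<ge> 0" "\<And>y. y \<ge> b \<Longrightarrow> \<bar>Digamma y\<bar> \<le> C + y"
    "\<And>y. y \<ge> b \<Longrightarrow> \<bar>ln (Gamma y)\<bar> \<le> C + y * (C + y)"
proof -
  define C where "C = \<bar>Digamma b\<bar> + \<bar>ln (Gamma b)\<bar> + 1"
  have psi: "\<bar>Digamma y\<bar> \<le> C + y" if y: "y \<ge> b" for y
  proof -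
    have "Digamma y \<le> y + 1"
    proof -
      define n where "n = nat \<lceil>y\<rceil>"
      have n: "y \<le> real n" "real n \<le> y + 1" using y assms by (auto simp: n_def) 
      have "Digamma y \<le> Digamma (real (Suc n))"
        using y assms n by (intro Digamma_real_mono) auto
      also have "\<dots> = harm n - euler_mascheroni" by (rule Digamma_of_nat)
      also have "\<dots> \<le> harm n" using euler_mascheroni_pos by simp
      also have "harm n \<le> real n"
      proof -
        have "harm n \<le> (\<Sum>k=1..n. 1 :: real)" unfolding harm_def
          by (intro sum_mono) (auto simp: inverse_le_1_iff)
        thus ?thesis by simp
      qed
      finally show ?thesis using n by simp
    qed
    moreover have "Digamma b \<le> Digamma y" using y assms by (intro Digamma_real_mono) auto
    ultimately show ?thesis unfolding C_def using y assms by linarith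
  qed
  have "\<bar>ln (Gamma y)\<bar> \<le> C + y * (C + y)" if y: "y \<ge> b" for y
  proof (cases "y = b")
    case False
    hence "b < y" using y by simp
    have "\<exists>z>b. z < y \<and> ln_Gamma y - ln_Gamma b = (y - b) * Digamma z"
      by (rule MVT2[OF \<open>b < y\<close>]) (use assms in \<open>auto intro!: has_field_derivative_ln_Gamma_real\<close>)
    then obtain z where z: "z > b" "z < y" "ln_Gamma y - ln_Gamma b = (y - b) * Digamma z" by blast
    have "\<bar>(y - b) * Digamma z\<bar> \<le> y * (C + y)"
      unfolding abs_mult using z psi[of z] y assms by (intro mult_mono) auto
    hence "\<bar>ln_Gamma y\<bar> \<le> \<bar>ln_Gamma b\<bar> + y * (C + y)" using z(3) by linarith
    thus ?thesis using y assms by (simp add: ln_Gamma_real_pos C_def)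
  next
    case True
    have "0 \<le> b * (C + b)" using assms by (simp add: C_def)
    thus ?thesis using True assms by (simp add: C_def)
  qed
  thus thesis using that[of C] psi by (auto simp: C_def)
qed

section \<open>Laplace transforms of powers and of powers times the logarithm\<close>

text \<open>
  Every \<open>s\<close> in the right half-plane lies in a disc \<open>\<bar>s - a\<bar> < a\<close> with real centre \<open>a\<close>. Expanding
  \<open>exp (- s t) = exp (- a t) \<Sum>n. ((a - s) t)\<^sup>n / n!\<close> and integrating term by term with the real
  case gives \<open>\<Gamma>(x) a\<^bsup>-x\<^esup>\<close> times the binomial series of \<open>(1 + (s - a) / a)\<^bsup>-x\<^esup> = (s / a)\<^bsup>-x\<^esup>\<close>.
\<close>
lemma laplace_powr_complex:
  fixes x :: real and s :: complex
  assumes x: "x > 0" and s: "Re s > 0"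
  shows "has_bochner_integral lborel
           (\<lambda>t. indicator {0<..} t *\<^sub>R (exp (- (s * of_real t)) * of_real (t powr (x - 1))))
           (of_real (Gamma x) / s powr of_real x)"
proof -
  \<comment> \<open>The disc condition \<open>\<bar>s - a\<bar> < a\<close> says \<open>\<bar>s\<bar>\<^sup>2 < 2 a Re s\<close>.\<close>
  define a where "a = (cmod s)\<^sup>2 / Re s"
  have s0: "s \<noteq> 0" using s by auto
  have a: "a > 0" using s s0 by (simp add: a_def)
  define w where "w = (of_real a - s) / of_real a"
  have w: "norm w < 1"
  proof -
    have "(cmod (of_real a - s))\<^sup>2 = a\<^sup>2 - 2 * (a * Re s) + (cmod s)\<^sup>2"
      unfolding cmod_power2 by (simp add: power2_eq_square algebra_simps)
    also have "a * Re s = (cmod s)\<^sup>2" using s by (simp add: a_def)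
    finally have "(cmod (of_real a - s))\<^sup>2 < a\<^sup>2" using s0 by simp
    hence "cmod (of_real a - s) < a" using a power_less_imp_less_base[of _ 2 a] by auto
    thus ?thesis using a by (simp add: w_def norm_divide)
  qed
  have x_nonpos: "x \<notin> \<int>\<^sub>\<le>\<^sub>0" using x by auto
  define f where "f = (\<lambda>n t. indicator {0<..} t *\<^sub>R
     ((of_real a - s) ^ n / fact n * of_real (exp (- (a * t)) * t powr (x + real n - 1))))"
  have f_altdef: "f n t = (of_real a - s) ^ n / fact n *
      of_real (indicator {0<..} t *\<^sub>R (exp (- (a * t)) * t powr (x + real n - 1)))" for n t
    by (simp add: f_def scaleR_conv_of_real mult_ac)
  have f_int: "has_bochner_integral lborel (f n)
      ((of_real a - s) ^ n / fact n * of_real (Gamma (x + real n) / a powr (x + real n)))" for n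
    unfolding f_altdef using x a
    by (intro has_bochner_integral_mult_right has_bochner_integral_of_real laplace_powr_real) auto
  have norm_f: "norm (f n t) = norm (of_real a - s) ^ n / fact n *
      (indicator {0<..} t *\<^sub>R (exp (- (a * t)) * t powr (x + real n - 1)))" for n t
    by (simp add: f_def norm_mult norm_divide norm_power mult_ac)
  have norm_f_int: "has_bochner_integral lborel (\<lambda>t. norm (f n t))
      (norm (of_real a - s) ^ n / fact n * (Gamma (x + real n) / a powr (x + real n)))" for n
    unfolding norm_f using x a
    by (intro has_bochner_integral_mult_right laplace_powr_real) auto
  have poch: "Gamma (x + real n) = Gamma x * pochhammer x n" for n
    using pochhammer_Gamma[OF x_nonpos, of n] x Gamma_real_pos[OF x] by (simp add: field_simps)
  have gch: "(- of_real x :: complex) gchoose n = (-1) ^ n * of_real (pochhammer x n) / fact n" for n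
    by (simp add: gbinomial_pochhammer pochhammer_of_real)
  have coeff: "(of_real a - s) ^ n / fact n * of_real (Gamma (x + real n) / a powr (x + real n)) =
      of_real (Gamma x / a powr x) * (((- of_real x) gchoose n) * (- w) ^ n)" for n
  proof -
    have "(of_real a - s) ^ n = of_real (a ^ n) * w ^ n"
      using a by (simp add: w_def power_divide)
    moreover have "(-1) ^ n * (- w) ^ n = w ^ n" by (simp flip: power_mult_distrib)
    ultimately show ?thesis using a
      by (simp add: gch poch powr_add powr_realpow field_simps)
  qed
  have sum1: "(\<lambda>n. (of_real a - s) ^ n / fact n * of_real (Gamma (x + real n) / a powr (x + real n)))
      sums (of_real (Gamma x / a powr x) * (1 + - w) powr (- of_real x))"
    unfolding coeff using w by (intro sums_mult gen_binomial_complex) simp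
  have summ: "summable (\<lambda>n. norm (of_real a - s) ^ n / fact n * (Gamma (x + real n) / a powr (x + real n)))"
  proof -
    have "summable (\<lambda>n. norm (((- of_real x) gchoose n) * (- w) ^ n))"
      by (rule abs_summable_in_conv_radius) (use w in \<open>auto simp: conv_radius_gchoose one_ereal_def\<close>)
    hence "summable (\<lambda>n. norm (of_real (Gamma x / a powr x) * (((- of_real x) gchoose n) * (- w) ^ n)))"
      unfolding norm_mult[of "of_real (Gamma x / a powr x)"] by (rule summable_mult)
    hence "summable (\<lambda>n. norm ((of_real a - s) ^ n / fact n * of_real (Gamma (x + real n) / a powr (x + real n))))"
      unfolding coeff .
    thus ?thesis using x by (simp add: norm_mult norm_divide norm_power)
  qed
  have expand: "f n t = indicator {0<..} t *\<^sub>R of_real (exp (- (a * t)) * t powr (x - 1)) *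
       (((of_real a - s) * of_real t) ^ n /\<^sub>R fact n)" for n t
    unfolding power_mult_distrib
    by (auto simp: f_def indicator_def powr_add powr_diff powr_realpow scaleR_conv_of_real field_simps)
  have expand_sums: "(\<lambda>n. f n t) sums (indicator {0<..} t *\<^sub>R of_real (exp (- (a * t)) * t powr (x - 1)) *
       exp ((of_real a - s) * of_real t))" for t
    unfolding expand by (intro sums_mult exp_converges)
  have summable_norm_f: "summable (\<lambda>n. norm (f n t))" for t
    unfolding expand norm_mult[of "indicator {0<..} t *\<^sub>R of_real _"]
    by (intro summable_mult summable_norm_exp)
  have suminf_f: "(\<Sum>n. f n t) = indicator {0<..} t *\<^sub>R (exp (- (s * of_real t)) * of_real (t powr (x - 1)))" for t
  proof -
    have "of_real (exp (- (a * t))) * exp ((of_real a - s) * of_real t) = exp (- (s * of_real t))"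
      by (simp add: exp_of_real[symmetric] exp_add[symmetric] algebra_simps)
    hence "indicator {0<..} t *\<^sub>R of_real (exp (- (a * t)) * t powr (x - 1)) * exp ((of_real a - s) * of_real t) =
        indicator {0<..} t *\<^sub>R (exp (- (s * of_real t)) * of_real (t powr (x - 1)))"
      by (simp add: scaleR_conv_of_real mult_ac)
    thus ?thesis by (rule trans[OF sums_unique[OF expand_sums[of t], symmetric]])
  qed
  have int_f: "integrable lborel (f n)" "integral\<^sup>L lborel (f n) = 
     (of_real a - s) ^ n / fact n * of_real (Gamma (x + real n) / a powr (x + real n))"
    "(LINT t|lborel. norm (f n t)) = norm (of_real a - s) ^ n / fact n * (Gamma (x + real n) / a powr (x + real n))" for n
    using f_int[of n] norm_f_int[of n] by (auto simp: has_bochner_integral_iff)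
  note ass = int_f(1) AE_I2[OF summable_norm_f] summ[folded int_f(3)]
  have "integrable lborel (\<lambda>t. \<Sum>n. f n t)" by (rule integrable_suminf[OF ass])
  moreover have "(LINT t|lborel. (\<Sum>n. f n t)) = of_real (Gamma x / a powr x) * (1 + - w) powr (- of_real x)"
    using sums_unique2[OF sums_integral[OF ass, unfolded int_f(2)] sum1] .
  moreover have "of_real (Gamma x / a powr x) * (1 + - w) powr (- of_real x) = of_real (Gamma x) / s powr of_real x"
  proof -
    have 1: "1 + - w = s / of_real a" using a by (simp add: w_def field_simps)
    have "s powr of_real x = (of_real a * (s / of_real a)) powr of_real x" using a by simp
    hence "s powr of_real x = of_real (a powr x) * (s / of_real a) powr of_real x"
      using a by (subst (asm) powr_times_real_left) (auto simp: powr_of_real)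
    thus ?thesis unfolding 1 using a by (simp add: powr_minus_divide)
  qed
  ultimately show ?thesis by (simp add: suminf_f has_bochner_integral_iff)
qed


text \<open>
  For large \<open>t\<close> the logarithm costs one power of \<open>t\<close>. Near \<open>0\<close> it costs the power \<open>t\<^bsup>-b/2\<^esup>\<close>, and there
  \<open>t\<^bsup>x-1\<^esup>\<close> is replaced by \<open>t\<^bsup>b-1\<^esup>\<close>, so that the second summand does not depend on \<open>x\<close>. Hence
  only \<open>\<Gamma>(x + 1) = x \<Gamma>(x)\<close> and a constant arise when the bound is integrated.
\<close>
lemma abs_ln_powr_le:
  fixes t x b :: real
  assumes t: "t > 0" and b: "0 < b" "b \<le> x"
  shows "\<bar>ln t\<bar> * t powr (x - 1) \<le> t powr x + 2 / b * t powr (b / 2 - 1)"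
proof (cases "t \<ge> 1")
  case True
  have "\<bar>ln t\<bar> * t powr (x - 1) \<le> t * t powr (x - 1)"
    using True ln_bound[of t] by (intro mult_right_mono) auto
  also have "\<dots> = t powr x" using t by (simp add: powr_diff)
  also have "\<dots> \<le> t powr x + 2 / b * t powr (b / 2 - 1)" using b by simp
  finally show ?thesis .
next
  case False
  have "ln (1 / t) \<le> (1 / t) powr (b / 2) / (b / 2)"
    using False t b by (intro ln_powr_bound) auto
  hence 1: "\<bar>ln t\<bar> \<le> 2 / b * t powr (- (b / 2))"
    using t False by (simp add: ln_div powr_minus powr_divide field_simps)
  have "\<bar>ln t\<bar> * t powr (x - 1) \<le> (2 / b * t powr (- (b / 2))) * t powr (b - 1)"
    using t b False by (intro mult_mono 1 powr_mono') auto
  also have "\<dots> = 2 / b * t powr (b / 2 - 1)" 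
    by (simp flip: powr_add)
  also have "\<dots> \<le> t powr x + 2 / b * t powr (b / 2 - 1)" by simp
  finally show ?thesis .
qed

lemma abs_exp_minus_one_le: "\<bar>exp y - 1\<bar> \<le> \<bar>y\<bar> * max 1 (exp (y::real))"
proof (cases "y \<ge> 0")
  case True
  have "1 - y \<le> exp (- y)" using exp_ge_add_one_self[of "- y"] by simp
  hence "exp y * (1 - y) \<le> exp y * exp (- y)" by (intro mult_left_mono) auto
  hence "exp y - 1 \<le> y * exp y" by (simp add: exp_minus algebra_simps)
  thus ?thesis using True by simp
next
  case False
  have "1 + y \<le> exp y" by simp
  hence "1 - exp y \<le> - y" by linarith
  thus ?thesis using False by (simp add: max_def abs_if)
qed

text \<open>
  The right-hand side is independent of \<open>h\<close> and, against \<open>exp (- \<sigma> t)\<close>, a sum of Euler integrals: it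
  dominates the difference quotients of \<open>t\<^bsup>x-1\<^esup>\<close> in \<open>x\<close>.
\<close>
lemma powr_difference_quotient_le:
  fixes t x h :: real
  assumes t: "t > 0" and x: "x > 0" and h: "0 < h" "h \<le> 1"
  shows "\<bar>(t powr (x + h - 1) - t powr (x - 1)) / h\<bar>
           \<le> t powr x + t powr (x + 1) + 4 / x * t powr (x / 2 - 1)"
proof -
  have "t powr (x + h - 1) - t powr (x - 1) = t powr (x - 1) * (exp (h * ln t) - 1)"
    using t by (simp add: powr_def exp_add[symmetric] algebra_simps)
  hence "\<bar>(t powr (x + h - 1) - t powr (x - 1)) / h\<bar> = t powr (x - 1) * (\<bar>exp (h * ln t) - 1\<bar> / h)"
    using h by (simp add: abs_mult)
  also have "\<bar>exp (h * ln t) - 1\<bar> / h \<le> \<bar>ln t\<bar> * max 1 (exp (h * ln t))"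
    using abs_exp_minus_one_le[of "h * ln t"] h by (simp add: abs_mult field_simps)
  also have "max 1 (exp (h * ln t)) \<le> 1 + t"
  proof (cases "t \<ge> 1")
    case True
    have "h * ln t \<le> 1 * ln t" using True h by (intro mult_right_mono) auto
    hence "exp (h * ln t) \<le> exp (ln t)" by simp
    also have "\<dots> = t" using t by simp
    finally have "exp (h * ln t) \<le> t" .
    thus ?thesis using t by simp
  next
    case False
    hence "exp (h * ln t) \<le> 1" using t h by (simp add: mult_le_0_iff)
    thus ?thesis using t by simp
  qed
  also have "t powr (x - 1) * (\<bar>ln t\<bar> * (1 + t)) = \<bar>ln t\<bar> * t powr (x - 1) + \<bar>ln t\<bar> * t powr (x + 1 - 1)"
    using t by (simp add: powr_diff field_simps)
  also have "\<dots> \<le> (t powr x + 2 / x * t powr (x / 2 - 1)) + (t powr (x + 1) + 2 / x * t powr (x / 2 - 1))"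
    using t x by (intro add_mono abs_ln_powr_le) auto
  also have "\<dots> = t powr x + t powr (x + 1) + 4 / x * t powr (x / 2 - 1)" by simp
  finally show ?thesis by (simp add: mult_left_mono mult_right_mono)
qed

lemma norm_exp_complex_mult_real: "norm (exp (- (s * of_real t))) = exp (- (Re s * t))"
  by (simp add: norm_exp_eq_Re)

text \<open>
  Since \<open>t\<^bsup>x-1\<^esup> ln t\<close> is the derivative of \<open>t\<^bsup>x-1\<^esup>\<close> with respect to \<open>x\<close>, the formula is the
  derivative of \<open>\<Gamma>(x) s\<^bsup>-x\<^esup>\<close>. Dominated convergence along the difference quotients with steps
  \<open>1 / (n + 1)\<close> justifies differentiating under the integral.
\<close>
lemma laplace_powr_ln_complex:
  fixes x :: real and s :: complex
  assumes x: "x > 0" and s: "Re s > 0"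
  shows "has_bochner_integral lborel
           (\<lambda>t. indicator {0<..} t *\<^sub>R (exp (- (s * of_real t)) * of_real (t powr (x - 1) * ln t)))
           (of_real (Gamma x) * (of_real (Digamma x) - ln s) / s powr of_real x)"
proof -
  define h where "h = (\<lambda>n. inverse (real (Suc n)))"
  have h: "0 < h n" "h n \<le> 1" for n by (auto simp: h_def inverse_le_1_iff)
  have h_lim: "filterlim h (at 0) sequentially"
    unfolding h_def by (rule filterlim_atI[OF LIMSEQ_inverse_real_of_nat]) auto
  define E where "E = (\<lambda>z. Gamma z * exp (- (z * ln s)))"
  have s0: "s \<noteq> 0" using s by auto
  have E_eq: "E (of_real y) = of_real (Gamma y) / s powr of_real y" for y :: real
    using s0 by (simp add: E_def powr_def Gamma_complex_of_real exp_minus field_simps)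
  define p where "p = (\<lambda>t y. indicator {0<..} t *\<^sub>R (exp (- (s * of_real t)) * of_real (t powr (y - 1))) :: complex)"
  have p_int: "has_bochner_integral lborel (\<lambda>t. p t y) (E (of_real y))" if "y > 0" for y
    unfolding p_def E_eq by (rule laplace_powr_complex[OF that s])
  define q where "q = (\<lambda>n t. (p t (x + h n) - p t x) / of_real (h n))"
  have q_int: "has_bochner_integral lborel (q n) ((E (of_real (x + h n)) - E (of_real x)) / of_real (h n))" for n
    unfolding q_def using x h[of n]
    by (intro has_bochner_integral_divide_zero has_bochner_integral_diff p_int) auto
  define f where "f = (\<lambda>t. indicator {0<..} t *\<^sub>R (exp (- (s * of_real t)) * of_real (t powr (x - 1) * ln t)) :: complex)"
  define w where "w = (\<lambda>t. indicator {0<..} t *\<^sub>R (exp (- (Re s * t)) * t powr (x + 1 - 1)) +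
       indicator {0<..} t *\<^sub>R (exp (- (Re s * t)) * t powr (x + 2 - 1)) +
       4 / x * (indicator {0<..} t *\<^sub>R (exp (- (Re s * t)) * t powr (x / 2 - 1))))"
  have w_int: "integrable lborel w"
  proof -
    have L: "integrable lborel (\<lambda>t. indicator {0<..} t *\<^sub>R (exp (- (Re s * t)) * t powr (y - 1)))" if "y > 0" for y
      using laplace_powr_real[OF that s] by (simp add: has_bochner_integral_iff)
    show ?thesis unfolding w_def
      by (intro Bochner_Integration.integrable_add integrable_mult_right L) (use x in auto)
  qed
  have q_le: "norm (q n t) \<le> w t" for n t
  proof (cases "t > 0")
    case True
    have "q n t = exp (- (s * of_real t)) * of_real ((t powr (x + h n - 1) - t powr (x - 1)) / h n)"
      using True by (simp add: q_def p_def field_simps)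
    hence "norm (q n t) = exp (- (Re s * t)) * \<bar>(t powr (x + h n - 1) - t powr (x - 1)) / h n\<bar>"
      by (simp only: norm_mult norm_of_real norm_exp_complex_mult_real)
    also have "\<dots> \<le> exp (- (Re s * t)) * (t powr x + t powr (x + 1) + 4 / x * t powr (x / 2 - 1))"
      using True x h by (intro mult_left_mono powr_difference_quotient_le) auto
    also have "\<dots> = w t" using True by (simp add: w_def algebra_simps)
    finally show ?thesis .
  qed (simp add: q_def p_def w_def)
  have q_lim: "(\<lambda>n. q n t) \<longlonglongrightarrow> f t" for t
  proof (cases "t > 0")
    case True
    have "((\<lambda>y. t powr (y - 1)) has_field_derivative t powr (x - 1) * ln t) (at x)"
      using True by (auto intro!: derivative_eq_intros)
    hence "((\<lambda>d. (t powr (x + d - 1) - t powr (x - 1)) / d) \<longlongrightarrow> t powr (x - 1) * ln t) (at 0)"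
      by (simp add: DERIV_def)
    from filterlim_compose[OF this h_lim]
    have "(\<lambda>n. exp (- (s * of_real t)) * of_real ((t powr (x + h n - 1) - t powr (x - 1)) / h n)) \<longlonglongrightarrow>
            exp (- (s * of_real t)) * of_real (t powr (x - 1) * ln t)"
      by (intro tendsto_intros)
    thus ?thesis using True by (simp add: q_def p_def f_def field_simps)
  qed (simp add: q_def p_def f_def)
  have q_meas: "q n \<in> borel_measurable lborel" for n
    using q_int[of n] by (auto simp: has_bochner_integral_iff)
  have f_meas: "f \<in> borel_measurable lborel"
    by (rule borel_measurable_LIMSEQ_metric[OF q_meas q_lim])
  note dc = f_meas q_meas w_int AE_I2[OF q_lim] AE_I2[OF q_le]
  have "integrable lborel f" by (rule integrable_dominated_convergence[OF dc])
  moreover have "(\<lambda>n. integral\<^sup>L lborel (q n)) \<longlonglongrightarrow> integral\<^sup>L lborel f"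
    by (rule integral_dominated_convergence[OF dc])
  moreover have "(\<lambda>n. integral\<^sup>L lborel (q n)) \<longlonglongrightarrow>
      of_real (Gamma x) * (of_real (Digamma x) - ln s) / s powr of_real x"
  proof -
    have "complex_of_real x \<notin> \<int>\<^sub>\<le>\<^sub>0" 
      using x by (subst of_real_in_nonpos_Ints_iff) auto
    hence "(E has_field_derivative (Gamma (of_real x) * Digamma (of_real x) * exp (- (of_real x * ln s)) +
             - (ln s) * exp (- (of_real x * ln s)) * Gamma (of_real x))) (at (of_real x))"
      unfolding E_def by (auto intro!: derivative_eq_intros)
    hence *: "((\<lambda>d. (E (of_real x + d) - E (of_real x)) / d) \<longlongrightarrow> 
        (Gamma (of_real x) * Digamma (of_real x) * exp (- (of_real x * ln s)) +
             - (ln s) * exp (- (of_real x * ln s)) * Gamma (of_real x))) (at 0)"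
      by (simp add: DERIV_def)
    have "filterlim (\<lambda>n. complex_of_real (h n)) (at 0) sequentially"
      by (rule filterlim_atI) (use h_lim h in \<open>auto simp: filterlim_at less_imp_neq[THEN not_sym] intro!: tendsto_eq_intros\<close>)
    from filterlim_compose[OF * this]
    have "(\<lambda>n. integral\<^sup>L lborel (q n)) \<longlonglongrightarrow> 
        (Gamma (of_real x) * Digamma (of_real x) * exp (- (of_real x * ln s)) +
             - (ln s) * exp (- (of_real x * ln s)) * Gamma (of_real x))"
      using q_int by (simp add: has_bochner_integral_iff)
    also have "(Gamma (of_real x) * Digamma (of_real x) * exp (- (of_real x * ln s)) +
             - (ln s) * exp (- (of_real x * ln s)) * Gamma (of_real x)) =
        of_real (Gamma x) * (of_real (Digamma x) - ln s) / s powr of_real x"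
      using s0 x by (simp add: powr_def Gamma_complex_of_real Polygamma_of_real exp_minus field_simps)
    finally show ?thesis .
  qed
  ultimately have "has_bochner_integral lborel f (of_real (Gamma x) * (of_real (Digamma x) - ln s) / s powr of_real x)"
    using LIMSEQ_unique by (auto simp: has_bochner_integral_iff)
  thus ?thesis by (simp add: f_def)
qed


section \<open>Termwise Laplace transform\<close>

text \<open>
  The coefficients \<open>a\<close> and \<open>b\<close> are arbitrary exponentially bounded sequences, so the powers of
  \<open>\<lambda>\<close> and all values of \<open>\<psi>\<close> and \<open>ln \<Gamma>\<close> are absorbed in them. With the estimate
  \<open>abs_ln_powr_le\<close>, the integral of the \<open>k\<close>-th term is at most an exponentially bounded sequence times
  \<open>\<Gamma>(x\<^sub>k)\<^bsup>1-\<gamma>\<^esup>\<close> plus another one times \<open>\<Gamma>(x\<^sub>k)\<^bsup>-\<gamma>\<^esup>\<close>, and both are summable.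
\<close>
lemma laplace_termwise:
  fixes \<alpha> \<beta> \<gamma> :: real and s :: complex and a b :: "nat \<Rightarrow> real" and f :: "real \<Rightarrow> real"
  assumes \<alpha>: "\<alpha> > 0" and \<beta>: "\<beta> > 0" and \<gamma>: "\<gamma> > 1" and s: "Re s > 0"
    and a: "exp_bounded a" and b: "exp_bounded b"
    and f: "\<And>t. t > 0 \<Longrightarrow> f t =
      (\<Sum>k. t powr (\<alpha> * real k + \<beta> - 1) * (a k * ln t + b k) * Gamma (\<alpha> * real k + \<beta>) powr (- \<gamma>))"
  shows "laplace_converges f s"
    and "(\<lambda>k. of_real (Gamma (\<alpha> * real k + \<beta>) powr (1 - \<gamma>)) / s powr of_real (\<alpha> * real k + \<beta>) *
           (of_real (a k) * (of_real (Digamma (\<alpha> * real k + \<beta>)) - ln s) + of_real (b k)))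
         sums laplace f s"
proof -
  define x where "x = (\<lambda>k. \<alpha> * real k + \<beta>)"
  define g where "g = (\<lambda>k. Gamma (x k) powr (- \<gamma>))"
  define \<sigma> where "\<sigma> = Re s"
  have x: "x k \<ge> \<beta>" "x k > 0" for k using \<alpha> \<beta> by (auto simp: x_def intro!: add_nonneg_pos)
  have g: "g k \<ge> 0" for k by (simp add: g_def)
  have \<sigma>: "\<sigma> > 0" using s by (simp add: \<sigma>_def)
  define F where "F = (\<lambda>k t. indicator {0<..} t *\<^sub>R (exp (- (s * of_real t)) *
      of_real (t powr (x k - 1) * (a k * ln t + b k) * g k)))"
  define I where "I = (\<lambda>k. of_real (Gamma (x k) powr (1 - \<gamma>)) / s powr of_real (x k) *
           (of_real (a k) * (of_real (Digamma (x k)) - ln s) + of_real (b k)))"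
  have F_eq: "F k t =
      of_real (g k * a k) * (indicator {0<..} t *\<^sub>R (exp (- (s * of_real t)) * of_real (t powr (x k - 1) * ln t))) +
      of_real (g k * b k) * (indicator {0<..} t *\<^sub>R (exp (- (s * of_real t)) * of_real (t powr (x k - 1))))" for k t
    by (simp add: F_def scaleR_conv_of_real algebra_simps)
  have F_int: "has_bochner_integral lborel (F k) (I k)" for k
  proof -
    have "has_bochner_integral lborel (F k)
       (of_real (g k * a k) * (of_real (Gamma (x k)) * (of_real (Digamma (x k)) - ln s) / s powr of_real (x k)) +
        of_real (g k * b k) * (of_real (Gamma (x k)) / s powr of_real (x k)))"
      unfolding F_eq
      by (intro has_bochner_integral_add has_bochner_integral_mult_right
                laplace_powr_ln_complex laplace_powr_complex x s)
    also have "Gamma (x k) powr (1 - \<gamma>) = g k * Gamma (x k)"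
      using Gamma_real_pos[OF x(2)[of k]] by (simp add: g_def powr_diff powr_minus field_simps)
    hence "of_real (g k * a k) * (of_real (Gamma (x k)) * (of_real (Digamma (x k)) - ln s) / s powr of_real (x k)) +
        of_real (g k * b k) * (of_real (Gamma (x k)) / s powr of_real (x k)) = I k"
      by (simp add: I_def add_divide_distrib diff_divide_distrib ring_distribs mult_ac)
    finally show ?thesis .
  qed
  \<comment> \<open>The dominating functions \<open>G k\<close> are combinations of the integrands \<open>P y\<close> of Euler integrals.\<close>
  define P where "P = (\<lambda>y t. indicator {0<..} t *\<^sub>R (exp (- (\<sigma> * t)) * t powr (y - 1)) :: real)"
  have P_int: "has_bochner_integral lborel (P y) (Gamma y / \<sigma> powr y)" if "y > 0" for y
    unfolding P_def by (rule laplace_powr_real[OF that \<sigma>])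
  define G where "G = (\<lambda>k t. g k * (\<bar>a k\<bar> * (P (x k + 1) t + 2 / \<beta> * P (\<beta> / 2) t) + \<bar>b k\<bar> * P (x k) t))"
  define J where "J = (\<lambda>k. g k * (\<bar>a k\<bar> * (Gamma (x k + 1) / \<sigma> powr (x k + 1) +
                    2 / \<beta> * (Gamma (\<beta> / 2) / \<sigma> powr (\<beta> / 2))) + \<bar>b k\<bar> * (Gamma (x k) / \<sigma> powr (x k))))"
  have G_int: "has_bochner_integral lborel (G k) (J k)" for k
    unfolding G_def J_def using x[of k] \<beta>
    by (intro has_bochner_integral_add has_bochner_integral_mult_right P_int) auto
  have F_le: "norm (F k t) \<le> G k t" for k t
  proof (cases "t > 0")
    case True
    have "\<bar>t powr (x k - 1) * (a k * ln t + b k) * g k\<bar> = g k * (t powr (x k - 1) * \<bar>a k * ln t + b k\<bar>)"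
      using g[of k] by (simp add: abs_mult mult_ac)
    also have "\<dots> \<le> g k * (t powr (x k - 1) * (\<bar>a k\<bar> * \<bar>ln t\<bar> + \<bar>b k\<bar>))"
      using g[of k] by (intro mult_left_mono) (auto simp flip: abs_mult)
    also have "\<dots> = g k * (\<bar>a k\<bar> * (\<bar>ln t\<bar> * t powr (x k - 1)) + \<bar>b k\<bar> * t powr (x k - 1))"
      by (simp add: algebra_simps)
    also have "\<dots> \<le> g k * (\<bar>a k\<bar> * (t powr x k + 2 / \<beta> * t powr (\<beta> / 2 - 1)) + \<bar>b k\<bar> * t powr (x k - 1))"
      using g[of k] True \<beta> x[of k] by (intro mult_left_mono add_right_mono abs_ln_powr_le) auto
    finally have "exp (- (\<sigma> * t)) * \<bar>t powr (x k - 1) * (a k * ln t + b k) * g k\<bar> \<le> 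
       exp (- (\<sigma> * t)) * (g k * (\<bar>a k\<bar> * (t powr x k + 2 / \<beta> * t powr (\<beta> / 2 - 1)) + \<bar>b k\<bar> * t powr (x k - 1)))"
      by (intro mult_left_mono) auto
    also have "\<dots> = G k t" using True by (simp add: G_def P_def algebra_simps)
    also have "exp (- (\<sigma> * t)) * \<bar>t powr (x k - 1) * (a k * ln t + b k) * g k\<bar> = norm (F k t)"
      using True by (simp only: F_def norm_mult norm_of_real norm_exp_complex_mult_real norm_scaleR \<sigma>_def) simp
    finally show ?thesis .
  qed (simp add: F_def G_def P_def)
  have eb_x: "exp_bounded x" unfolding x_def by (rule exp_bounded_affine)
  have "summable J"
  proof -
    define U where "U = (\<lambda>k. \<bar>a k\<bar> * x k * \<sigma> powr ((- \<alpha>) * real k + (- \<beta> - 1)) + \<bar>b k\<bar> * \<sigma> powr ((- \<alpha>) * real k + (- \<beta>)))"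
    define V where "V = (\<lambda>k. \<bar>a k\<bar> * (2 / \<beta> * (Gamma (\<beta> / 2) / \<sigma> powr (\<beta> / 2))))"
    have "exp_bounded U" "exp_bounded V"
      unfolding U_def V_def by (intro exp_bounded_intros a b eb_x)+
    hence "summable (\<lambda>k. \<bar>U k\<bar> * Gamma (x k) powr (- (\<gamma> - 1)) + \<bar>V k\<bar> * Gamma (x k) powr (- \<gamma>))"
      unfolding x_def using \<alpha> \<beta> \<gamma> by (intro summable_add summable_exp_bounded_Gamma_powr) auto
    moreover have "J k = \<bar>U k\<bar> * Gamma (x k) powr (- (\<gamma> - 1)) + \<bar>V k\<bar> * Gamma (x k) powr (- \<gamma>)" for k
    proof -
      have "x k \<notin> \<int>\<^sub>\<le>\<^sub>0" using x(2)[of k] by auto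
      hence G1: "Gamma (x k + 1) = x k * Gamma (x k)" by (rule Gamma_plus1)
      have G2: "Gamma (x k) powr (- (\<gamma> - 1)) = g k * Gamma (x k)"
        using Gamma_real_pos[OF x(2)[of k]] by (simp add: g_def powr_diff powr_minus field_simps)
      have e1: "\<sigma> powr ((- \<alpha>) * real k + (- \<beta> - 1)) = 1 / \<sigma> powr (x k + 1)"
        unfolding powr_minus_divide[symmetric] by (rule arg_cong[where f = "\<lambda>z. \<sigma> powr z"]) (simp add: x_def)
      have e2: "\<sigma> powr ((- \<alpha>) * real k + (- \<beta>)) = 1 / \<sigma> powr (x k)"
        unfolding powr_minus_divide[symmetric] by (rule arg_cong[where f = "\<lambda>z. \<sigma> powr z"]) (simp add: x_def)
      have "U k \<ge> 0" "V k \<ge> 0" unfolding U_def V_def using x(2)[of k] \<beta>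
        by (auto intro!: add_nonneg_nonneg mult_nonneg_nonneg divide_nonneg_nonneg)
      hence "\<bar>U k\<bar> = U k" "\<bar>V k\<bar> = V k" by simp_all
      thus ?thesis unfolding J_def U_def V_def e1 e2 G1 G2 by (simp add: g_def algebra_simps)
    qed
    ultimately show ?thesis by presburger
  qed
  have norm_F_le: "(LINT t|lborel. norm (F k t)) \<le> J k" for k
  proof -
    have "(LINT t|lborel. norm (F k t)) \<le> integral\<^sup>L lborel (G k)"
      using F_int[of k] G_int[of k] F_le by (intro integral_mono) (auto simp: has_bochner_integral_iff)
    thus ?thesis using G_int[of k] by (simp add: has_bochner_integral_iff)
  qed
  have summable_int: "summable (\<lambda>k. LINT t|lborel. norm (F k t))"
    by (rule summable_comparison_test'[OF \<open>summable J\<close>]) (use norm_F_le in auto)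
  have F_sum: "summable (\<lambda>k. norm (F k t))" for t
  proof (cases "t > 0")
    case True
    have "exp_bounded (\<lambda>k. exp (- (\<sigma> * t)) * (t powr (\<alpha> * real k + (\<beta> - 1)) * (a k * ln t + b k)))"
      by (intro exp_bounded_intros a b)
    from summable_exp_bounded_Gamma_powr[OF this \<alpha> \<beta>, of \<gamma>]
    have "summable (\<lambda>k. \<bar>exp (- (\<sigma> * t)) * (t powr (\<alpha> * real k + (\<beta> - 1)) * (a k * ln t + b k))\<bar> *
            Gamma (\<alpha> * real k + \<beta>) powr (- \<gamma>))" using \<gamma> by simp
    also have "(\<lambda>k. \<bar>exp (- (\<sigma> * t)) * (t powr (\<alpha> * real k + (\<beta> - 1)) * (a k * ln t + b k))\<bar> *
            Gamma (\<alpha> * real k + \<beta>) powr (- \<gamma>)) = (\<lambda>k. norm (F k t))"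
      using True
      by (simp only: F_def norm_scaleR norm_mult norm_of_real norm_exp_complex_mult_real)
         (simp add: \<sigma>_def g_def x_def abs_mult mult_ac diff_add_eq add_diff_eq)
    finally show ?thesis .
  qed (simp add: F_def)
  have F_suminf: "(\<Sum>k. F k t) = indicator {0<..} t *\<^sub>R (exp (- (s * of_real t)) * of_real (f t))" for t
  proof (cases "t > 0")
    case True
    have "summable (\<lambda>k. exp (- (s * of_real t)) * complex_of_real (t powr (x k - 1) * (a k * ln t + b k) * g k))"
      using summable_norm_cancel[OF F_sum[of t]] True by (simp add: F_def)
    hence summ: "summable (\<lambda>k. t powr (x k - 1) * (a k * ln t + b k) * g k)"
      using summable_cmult_iff[of "exp (- (s * of_real t))"] summable_of_real_iff by fastforce
    have "(\<Sum>k. F k t) = (\<Sum>k. exp (- (s * of_real t)) * complex_of_real (t powr (x k - 1) * (a k * ln t + b k) * g k))"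
      using True by (simp add: F_def)
    also have "\<dots> = exp (- (s * of_real t)) * of_real (\<Sum>k. t powr (x k - 1) * (a k * ln t + b k) * g k)"
      using summ by (simp only: suminf_mult suminf_of_real summable_of_real)
    finally show ?thesis using True f[OF True] by (simp add: x_def g_def)
  qed (simp add: F_def)
  have F_int': "integrable lborel (F k)" "integral\<^sup>L lborel (F k) = I k" for k
    using F_int[of k] by (auto simp: has_bochner_integral_iff)
  note ass = F_int'(1) AE_I2[OF F_sum] summable_int
  show "laplace_converges f s"
    using integrable_suminf[OF ass] unfolding F_suminf laplace_converges_def set_integrable_def .
  show "(\<lambda>k. of_real (Gamma (\<alpha> * real k + \<beta>) powr (1 - \<gamma>)) / s powr of_real (\<alpha> * real k + \<beta>) *
           (of_real (a k) * (of_real (Digamma (\<alpha> * real k + \<beta>)) - ln s) + of_real (b k)))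
         sums laplace f s"
    using sums_integral[OF ass] unfolding F_suminf F_int' laplace_def set_lebesgue_integral_def I_def x_def .
qed


section \<open>Directional derivatives of the Le Roy kernel\<close>

text \<open>
  Writing each term as one exponential puts all three parameters into the exponent, where
  differentiation is immediate.
\<close>
lemma le_roy_kernel_sums:
  fixes a b c l t :: real
  assumes "a > 0" "b > 0" "c > 0" "t > 0"
  shows "(\<lambda>k. l ^ k * exp ((a * real k + b - 1) * ln t - c * ln_Gamma (a * real k + b)))
           sums le_roy_kernel a b c l t"
proof -
  have "summable (\<lambda>k. \<bar>(l * t powr a) ^ k\<bar> * Gamma (a * real k + b) powr (- c))"
    using assms by (intro summable_exp_bounded_Gamma_powr exp_bounded_power) auto
  hence "summable (\<lambda>k. norm ((l * t powr a) ^ k / Gamma (a * real k + b) powr c))"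
    by (simp add: powr_minus_divide)
  from summable_sums[OF summable_norm_cancel[OF this]]
  have "(\<lambda>k. t powr (b - 1) * ((l * t powr a) ^ k / Gamma (a * real k + b) powr c)) sums le_roy_kernel a b c l t"
    unfolding le_roy_kernel_def le_roy_def by (intro sums_mult) simp
  also have "(\<lambda>k. t powr (b - 1) * ((l * t powr a) ^ k / Gamma (a * real k + b) powr c)) =
    (\<lambda>k. l ^ k * exp ((a * real k + b - 1) * ln t - c * ln_Gamma (a * real k + b)))"
  proof
    fix k
    have pos: "a * real k + b > 0" using assms by (intro add_nonneg_pos) auto
    have "(t powr a) ^ k = exp (a * real k * ln t)"
      using assms by (simp add: powr_def mult_ac flip: exp_of_nat_mult)
    moreover have "Gamma (a * real k + b) powr c = exp (c * ln_Gamma (a * real k + b))"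
      using less_imp_neq[OF Gamma_real_pos[OF pos]] pos by (auto simp: powr_def ln_Gamma_real_pos)
    moreover have "t powr (b - 1) = exp ((b - 1) * ln t)" using assms by (simp add: powr_def)
    ultimately show "t powr (b - 1) * ((l * t powr a) ^ k / Gamma (a * real k + b) powr c) =
       l ^ k * exp ((a * real k + b - 1) * ln t - c * ln_Gamma (a * real k + b))"
      by (simp add: power_mult_distrib exp_add[symmetric] exp_diff algebra_simps)
  qed
  finally show ?thesis .
qed

text \<open>
  For such \<open>h\<close> each perturbed parameter stays between half and twice its original value.
\<close>
lemma small_perturbation:
  fixes \<alpha> \<beta> \<gamma> u w v :: real
  assumes "\<alpha> > 0" "\<beta> > 0" "\<gamma> > 0"
  obtains \<delta> where "\<delta> > 0"
    "\<And>h. \<bar>h\<bar> < \<delta> \<Longrightarrow> \<bar>u * h\<bar> \<le> \<alpha> / 2 \<and> \<bar>w * h\<bar> \<le> \<beta> / 2 \<and> \<bar>v * h\<bar> \<le> \<gamma> / 2"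
proof -
  have "\<forall>\<^sub>F h in at 0. \<bar>p * h\<bar> < q / 2" if "q > 0" for p q :: real
  proof (rule order_tendstoD(2))
    have "((\<lambda>h. \<bar>p * h\<bar>) \<longlongrightarrow> \<bar>p * 0\<bar>) (at 0)" by (intro tendsto_intros)
    thus "((\<lambda>h. \<bar>p * h\<bar>) \<longlongrightarrow> 0) (at 0)" by simp
  qed (use that in simp)
  hence "\<forall>\<^sub>F h in at 0. \<bar>u * h\<bar> < \<alpha> / 2 \<and> \<bar>w * h\<bar> < \<beta> / 2 \<and> \<bar>v * h\<bar> < \<gamma> / 2"
    using assms by (intro eventually_conj) auto
  then obtain d where d: "d > 0"
    "\<And>h. h \<noteq> 0 \<Longrightarrow> dist h 0 < d \<Longrightarrow> \<bar>u * h\<bar> < \<alpha> / 2 \<and> \<bar>w * h\<bar> < \<beta> / 2 \<and> \<bar>v * h\<bar> < \<gamma> / 2"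
    unfolding eventually_at by blast
  show thesis
  proof (rule that[OF d(1)])
    fix h :: real assume "\<bar>h\<bar> < d"
    thus "\<bar>u * h\<bar> \<le> \<alpha> / 2 \<and> \<bar>w * h\<bar> \<le> \<beta> / 2 \<and> \<bar>v * h\<bar> \<le> \<gamma> / 2"
      using d(2)[of h] assms by (cases "h = 0") auto
  qed
qed

text \<open>
  Termwise differentiation needs a summable bound for the derivatives \<open>F' k h\<close> that is uniform in
  small \<open>h\<close>. The perturbed argument \<open>y k h = x k + \<omega> k * h\<close> lies between \<open>x k / 2\<close> and \<open>2 * x k\<close>, and
  the exponent between \<open>\<gamma> / 2\<close> and \<open>2 * \<gamma>\<close>. The upper ends bound the logarithmic factors by an
  exponentially bounded sequence \<open>T\<close>; the lower ends feed the Gamma majorant.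
\<close>
lemma le_roy_kernel_directional_derivative:
  fixes \<alpha> \<beta> \<gamma> l t u w v :: real
  assumes \<alpha>: "\<alpha> > 0" and \<beta>: "\<beta> > 0" and \<gamma>: "\<gamma> > 0" and t: "t > 0"
  shows "((\<lambda>h. le_roy_kernel (\<alpha> + u * h) (\<beta> + w * h) (\<gamma> + v * h) l t) has_real_derivative
     (\<Sum>k. t powr (\<alpha> * real k + \<beta> - 1) *
        (l ^ k * (u * real k + w) * ln t
           + (- (l ^ k * (\<gamma> * (u * real k + w) * Digamma (\<alpha> * real k + \<beta>) + v * ln (Gamma (\<alpha> * real k + \<beta>))))))
        * Gamma (\<alpha> * real k + \<beta>) powr (- \<gamma>))) (at 0)"
proof -
  define x where "x = (\<lambda>k. \<alpha> * real k + \<beta>)"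
  define \<omega> where "\<omega> = (\<lambda>k. u * real k + w)"
  define y where "y = (\<lambda>k h. (\<alpha> + u * h) * real k + (\<beta> + w * h))"
  have y_eq: "y k h = x k + \<omega> k * h" for k h by (simp add: y_def x_def \<omega>_def algebra_simps)
  obtain \<delta> where \<delta>: "\<delta> > 0"
    "\<And>h. \<bar>h\<bar> < \<delta> \<Longrightarrow> \<bar>u * h\<bar> \<le> \<alpha> / 2 \<and> \<bar>w * h\<bar> \<le> \<beta> / 2 \<and> \<bar>v * h\<bar> \<le> \<gamma> / 2"
    using small_perturbation[OF \<alpha> \<beta> \<gamma>] by blast
  define S where "S = {- \<delta> <..< \<delta>}"
  have S: "\<bar>u * h\<bar> \<le> \<alpha> / 2" "\<bar>w * h\<bar> \<le> \<beta> / 2" "\<bar>v * h\<bar> \<le> \<gamma> / 2" if "h \<in> S" for h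
    using \<delta>(2)[of h] that by (auto simp: S_def)
  have pos: "\<alpha> + u * h \<ge> \<alpha> / 2" "\<beta> + w * h \<ge> \<beta> / 2" "\<gamma> + v * h \<ge> \<gamma> / 2" "\<gamma> + v * h \<le> 2 * \<gamma>" 
    "\<alpha> + u * h \<le> 2 * \<alpha>" "\<beta> + w * h \<le> 2 * \<beta>" if "h \<in> S" for h
    using S[OF that] \<alpha> \<beta> \<gamma> by (auto simp: abs_le_iff)
  have y_ge: "y k h \<ge> \<alpha> / 2 * real k + \<beta> / 2" and y_le: "y k h \<le> 2 * x k" if "h \<in> S" for k h
  proof -
    have "\<alpha> / 2 * real k \<le> (\<alpha> + u * h) * real k" "(\<alpha> + u * h) * real k \<le> (2 * \<alpha>) * real k"
      using pos[OF that] by (intro mult_right_mono; simp)+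
    thus "y k h \<ge> \<alpha> / 2 * real k + \<beta> / 2" "y k h \<le> 2 * x k"
      using pos[OF that] unfolding y_def x_def by (simp_all add: algebra_simps)
  qed
  have y_ge': "y k h \<ge> \<beta> / 2" "y k h > 0" if "h \<in> S" for k h
  proof -
    have "0 \<le> \<alpha> / 2 * real k" using \<alpha> by simp
    thus "y k h \<ge> \<beta> / 2" using y_ge[OF that, of k] by linarith
    thus "y k h > 0" using \<beta> by linarith
  qed
  obtain C where C: "C \<ge> 0" "\<And>y. y \<ge> \<beta> / 2 \<Longrightarrow> \<bar>Digamma y\<bar> \<le> C + y"
    "\<And>y. y \<ge> \<beta> / 2 \<Longrightarrow> \<bar>ln (Gamma y)\<bar> \<le> C + y * (C + y)"
    using Digamma_ln_Gamma_real_bounds[of "\<beta> / 2"] \<beta> by auto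
  define F where "F = (\<lambda>k h. l ^ k * exp ((y k h - 1) * ln t - (\<gamma> + v * h) * ln_Gamma (y k h)))"
  define F' where "F' = (\<lambda>k h. F k h * (\<omega> k * ln t - (v * ln_Gamma (y k h) + Digamma (y k h) * \<omega> k * (\<gamma> + v * h))))"
  have F_deriv: "(F k has_real_derivative F' k h) (at h within S)" if "h \<in> S" for k h
  proof -
    have y': "(y k has_real_derivative \<omega> k) (at h within S)"
      unfolding y_eq by (auto intro!: derivative_eq_intros)
    have G': "((\<lambda>h. ln_Gamma (y k h)) has_real_derivative Digamma (y k h) * \<omega> k) (at h within S)"
      by (rule DERIV_chain2[OF has_field_derivative_ln_Gamma_real[OF y_ge'(2)[OF that]] y'])
    show ?thesis unfolding F_def F'_def
      by (rule derivative_eq_intros y' G' refl)+ (simp add: algebra_simps)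
  qed
  define T where "T = (\<lambda>k. l ^ k * exp (2 * \<bar>ln t\<bar> * \<alpha> * real k + (2 * \<beta> + 1) * \<bar>ln t\<bar>) *
     (\<bar>\<omega> k\<bar> * \<bar>ln t\<bar> + (\<bar>v\<bar> * (C + 2 * x k * (C + 2 * x k)) + (C + 2 * x k) * \<bar>\<omega> k\<bar> * (2 * \<gamma>))))"
  have "exp_bounded T"
    unfolding T_def \<omega>_def x_def by (intro exp_bounded_intros)
  then obtain M where M: "summable M"
    "\<And>k y c. y \<ge> \<alpha> / 2 * real k + \<beta> / 2 \<Longrightarrow> \<gamma> / 2 \<le> c \<Longrightarrow> c \<le> 2 * \<gamma> \<Longrightarrow> \<bar>T k\<bar> * Gamma y powr (- c) \<le> M k"
    using exp_bounded_Gamma_powr_majorant[of T "\<alpha> / 2" "\<beta> / 2" "\<gamma> / 2" "2 * \<gamma>"] \<alpha> \<beta> \<gamma> by auto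
  have F'_le: "norm (F' k h) \<le> M k" if "h \<in> S" for k h
  proof -
    note yh = y_ge'[OF that, of k]
    let ?c = "\<gamma> + v * h"
    have e1: "exp ((y k h - 1) * ln t) \<le> exp (2 * \<bar>ln t\<bar> * \<alpha> * real k + (2 * \<beta> + 1) * \<bar>ln t\<bar>)"
    proof -
      have "(y k h - 1) * ln t \<le> \<bar>y k h - 1\<bar> * \<bar>ln t\<bar>" by (metis abs_ge_self abs_mult)
      also have "\<dots> \<le> (2 * x k + 1) * \<bar>ln t\<bar>"
        using yh y_le[OF that, of k] by (intro mult_right_mono) auto
      finally show ?thesis by (simp add: x_def algebra_simps)
    qed
    have e2: "exp (- (?c * ln_Gamma (y k h))) = Gamma (y k h) powr (- ?c)"
      using yh less_imp_neq[OF Gamma_real_pos[OF yh(2)]]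
      by (auto simp: powr_def ln_Gamma_real_pos algebra_simps)
    have psi: "\<bar>Digamma (y k h)\<bar> \<le> C + 2 * x k"
      using C(2)[OF yh(1)] y_le[OF that, of k] by linarith
    have lg: "\<bar>ln_Gamma (y k h)\<bar> \<le> C + 2 * x k * (C + 2 * x k)"
    proof -
      have "y k h * (C + y k h) \<le> 2 * x k * (C + 2 * x k)"
        using yh y_le[OF that, of k] C(1) by (intro mult_mono) auto
      thus ?thesis using C(3)[OF yh(1)] yh by (simp add: ln_Gamma_real_pos)
    qed
    have c: "\<bar>?c\<bar> \<le> 2 * \<gamma>" using pos(3,4)[OF that] \<gamma> by auto
    have fac: "\<bar>\<omega> k * ln t - (v * ln_Gamma (y k h) + Digamma (y k h) * \<omega> k * ?c)\<bar> \<le>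
       \<bar>\<omega> k\<bar> * \<bar>ln t\<bar> + (\<bar>v\<bar> * (C + 2 * x k * (C + 2 * x k)) + (C + 2 * x k) * \<bar>\<omega> k\<bar> * (2 * \<gamma>))" (is "_ \<le> ?R")
    proof -
      have "\<bar>v * ln_Gamma (y k h)\<bar> \<le> \<bar>v\<bar> * (C + 2 * x k * (C + 2 * x k))"
        unfolding abs_mult by (intro mult_left_mono lg) auto
      moreover have "\<bar>Digamma (y k h) * \<omega> k * ?c\<bar> \<le> (C + 2 * x k) * \<bar>\<omega> k\<bar> * (2 * \<gamma>)"
        unfolding abs_mult using psi c by (intro mult_mono) auto
      moreover have "\<bar>\<omega> k * ln t\<bar> = \<bar>\<omega> k\<bar> * \<bar>ln t\<bar>" by (rule abs_mult)
      ultimately show ?thesis by linarith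
    qed
    have "norm (F' k h) = \<bar>l ^ k\<bar> * (exp ((y k h - 1) * ln t) * Gamma (y k h) powr (- ?c)) *
        \<bar>\<omega> k * ln t - (v * ln_Gamma (y k h) + Digamma (y k h) * \<omega> k * ?c)\<bar>"
      unfolding F'_def F_def e2[symmetric] by (simp add: abs_mult flip: exp_add)
    also have "\<dots> \<le> \<bar>l ^ k\<bar> * (exp (2 * \<bar>ln t\<bar> * \<alpha> * real k + (2 * \<beta> + 1) * \<bar>ln t\<bar>) * Gamma (y k h) powr (- ?c)) * ?R"
      by (intro mult_mono fac mult_left_mono mult_right_mono e1) auto
    also have "\<dots> \<le> \<bar>T k\<bar> * Gamma (y k h) powr (- ?c)"
    proof -
      have "?R \<ge> 0" using fac by linarith
      thus ?thesis by (simp add: T_def abs_mult mult_ac)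
    qed
    also have "\<dots> \<le> M k" by (rule M(2)[OF y_ge[OF that] pos(3,4)[OF that]])
    finally show ?thesis .
  qed
  have F_sums: "(\<lambda>k. F k h) sums le_roy_kernel (\<alpha> + u * h) (\<beta> + w * h) (\<gamma> + v * h) l t" if "h \<in> S" for h
    unfolding F_def y_def using pos[OF that] \<alpha> \<beta> \<gamma> t by (intro le_roy_kernel_sums) auto
  have S0: "0 \<in> S" "open S" "convex S" using \<delta>(1) by (auto simp: S_def)
  have unif: "uniformly_convergent_on S (\<lambda>n h. \<Sum>k<n. F' k h)"
    by (rule Weierstrass_m_test'[OF _ M(1)]) (use F'_le in auto)
  have "((\<lambda>h. \<Sum>k. F k h) has_real_derivative (\<Sum>k. F' k 0)) (at 0)"
    by (rule has_field_derivative_series'(2)[OF S0(3) F_deriv unif S0(1) sums_summable[OF F_sums[OF S0(1)]]])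
       (use S0 in \<open>auto simp: interior_open\<close>)
  hence "((\<lambda>h. le_roy_kernel (\<alpha> + u * h) (\<beta> + w * h) (\<gamma> + v * h) l t) has_real_derivative (\<Sum>k. F' k 0)) (at 0)"
    by (rule has_field_derivative_transform_within_open[OF _ S0(2,1)]) (use F_sums in \<open>auto simp: sums_iff\<close>)
  also have "(\<lambda>k. F' k 0) = (\<lambda>k. t powr (x k - 1) *
      (l ^ k * \<omega> k * ln t + (- (l ^ k * (\<gamma> * \<omega> k * Digamma (x k) + v * ln (Gamma (x k))))))
        * Gamma (x k) powr (- \<gamma>))"
  proof
    fix k
    have xk: "x k > 0" using y_ge'(2)[OF S0(1), of k] by (simp add: y_eq)
    have "F k 0 = l ^ k * (t powr (x k - 1) * Gamma (x k) powr (- \<gamma>))"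
      using xk t less_imp_neq[OF Gamma_real_pos[OF xk]]
      by (auto simp: F_def y_eq powr_def ln_Gamma_real_pos simp flip: exp_add)
    thus "F' k 0 = t powr (x k - 1) *
      (l ^ k * \<omega> k * ln t + (- (l ^ k * (\<gamma> * \<omega> k * Digamma (x k) + v * ln (Gamma (x k))))))
        * Gamma (x k) powr (- \<gamma>)"
      using xk by (simp add: F'_def y_eq ln_Gamma_real_pos algebra_simps)
  qed
  finally show ?thesis unfolding x_def \<omega>_def .
qed

section \<open>Laplace transforms of the parameter derivatives\<close>

text \<open>
  The family \<open>K\<close> is the kernel along a line in parameter space, parametrised so that the base
  point sits at \<open>p\<close>; each partial derivative is then an instance in its own variable.
\<close>
lemma laplace_le_roy_directional:
  fixes \<alpha> \<beta> \<gamma> l u w v :: real and s :: complex and K :: "real \<Rightarrow> real \<Rightarrow> real"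
  assumes \<alpha>: "\<alpha> > 0" and \<beta>: "\<beta> > 0" and \<gamma>: "\<gamma> > 1" and s: "Re s > 0"
    and K: "\<And>h t. K (p + h) t = le_roy_kernel (\<alpha> + u * h) (\<beta> + w * h) (\<gamma> + v * h) l t"
    and c: "\<And>k. c k = (of_real l / s powr of_real \<alpha>) ^ k *
              ((of_real (u * real k + w) * (ln s + of_real ((\<gamma> - 1) * Digamma (\<alpha> * real k + \<beta>)))
                  + of_real (v * ln (Gamma (\<alpha> * real k + \<beta>))))
                / of_real (Gamma (\<alpha> * real k + \<beta>) powr (\<gamma> - 1)))"
  shows "(\<forall>t>0. (\<lambda>q. K q t) field_differentiable at p) \<and>
         laplace_converges (\<lambda>t. deriv (\<lambda>q. K q t) p) s \<and>
         (\<exists>S. c sums S \<and> laplace (\<lambda>t. deriv (\<lambda>q. K q t) p) s = - (1 / s powr of_real \<beta>) * S)"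
proof -
  define x where "x = (\<lambda>k. \<alpha> * real k + \<beta>)"
  define \<omega> where "\<omega> = (\<lambda>k. u * real k + w)"
  define a where "a = (\<lambda>k. l ^ k * \<omega> k)"
  define b where "b = (\<lambda>k. - (l ^ k * (\<gamma> * \<omega> k * Digamma (x k) + v * ln (Gamma (x k)))))"
  have x: "x k \<ge> \<beta>" "x k > 0" for k using \<alpha> \<beta> by (auto simp: x_def intro!: add_nonneg_pos)
  have s0: "s \<noteq> 0" using s by auto
  define D where "D = (\<lambda>t. deriv (\<lambda>q. K q t) p)"
  have K_deriv: "((\<lambda>q. K q t) has_real_derivative
      (\<Sum>k. t powr (\<alpha> * real k + \<beta> - 1) * (a k * ln t + b k) * Gamma (\<alpha> * real k + \<beta>) powr (- \<gamma>))) (at p)"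
    if "t > 0" for t
  proof -
    have "((\<lambda>h. K (h + p) t) has_real_derivative
      (\<Sum>k. t powr (\<alpha> * real k + \<beta> - 1) * (a k * ln t + b k) * Gamma (\<alpha> * real k + \<beta>) powr (- \<gamma>))) (at 0)"
      using le_roy_kernel_directional_derivative[OF \<alpha> \<beta> _ that, of \<gamma> u w v l] \<gamma>
      by (simp add: add.commute[of _ p] K a_def b_def x_def \<omega>_def)
    thus ?thesis using DERIV_shift[of "\<lambda>q. K q t" _ 0 p] by simp
  qed
  have D: "D t = (\<Sum>k. t powr (\<alpha> * real k + \<beta> - 1) * (a k * ln t + b k) * Gamma (\<alpha> * real k + \<beta>) powr (- \<gamma>))"
    if "t > 0" for t unfolding D_def by (rule DERIV_imp_deriv[OF K_deriv[OF that]])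
  have eb_x: "exp_bounded x" and eb_\<omega>: "exp_bounded \<omega>" unfolding x_def \<omega>_def by (rule exp_bounded_affine)+
  obtain C where C: "C \<ge> 0" "\<And>y. y \<ge> \<beta> \<Longrightarrow> \<bar>Digamma y\<bar> \<le> C + y"
    "\<And>y. y \<ge> \<beta> \<Longrightarrow> \<bar>ln (Gamma y)\<bar> \<le> C + y * (C + y)"
    using Digamma_ln_Gamma_real_bounds[OF \<beta>] by blast
  have eb_psi: "exp_bounded (\<lambda>k. Digamma (x k))"
  proof (rule exp_bounded_mono)
    show "exp_bounded (\<lambda>k. C + x k)" by (intro exp_bounded_intros eb_x)
    show "\<bar>Digamma (x k)\<bar> \<le> \<bar>C + x k\<bar>" for k using C(2)[OF x(1)[of k]] by linarith
  qed
  have eb_lg: "exp_bounded (\<lambda>k. ln (Gamma (x k)))"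
  proof (rule exp_bounded_mono)
    show "exp_bounded (\<lambda>k. C + x k * (C + x k))" by (intro exp_bounded_intros eb_x)
    show "\<bar>ln (Gamma (x k))\<bar> \<le> \<bar>C + x k * (C + x k)\<bar>" for k using C(3)[OF x(1)[of k]] by linarith
  qed
  have ab: "exp_bounded a" "exp_bounded b"
    unfolding a_def b_def by (intro exp_bounded_intros eb_\<omega> eb_psi eb_lg)+
  note L = laplace_termwise[OF \<alpha> \<beta> \<gamma> s ab D]
  \<comment> \<open>Multiplying the termwise transform by \<open>- s\<^sup>\<beta>\<close> isolates the series with coefficients \<open>c\<close>.\<close>
  have "(\<lambda>k. - (s powr of_real \<beta>) * (of_real (Gamma (x k) powr (1 - \<gamma>)) / s powr of_real (x k) *
           (of_real (a k) * (of_real (Digamma (x k)) - ln s) + of_real (b k))))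
         sums (- (s powr of_real \<beta>) * laplace D s)"
    unfolding x_def by (intro sums_mult L(2))
  also have "(\<lambda>k. - (s powr of_real \<beta>) * (of_real (Gamma (x k) powr (1 - \<gamma>)) / s powr of_real (x k) *
           (of_real (a k) * (of_real (Digamma (x k)) - ln s) + of_real (b k)))) = c"
  proof
    fix k
    have split: "s powr of_real (x k) = (s powr of_real \<alpha>) ^ k * s powr of_real \<beta>"
      using s0 by (simp add: x_def powr_def exp_add[symmetric] exp_of_nat_mult[symmetric] algebra_simps)
    have 2: "Gamma (x k) powr (1 - \<gamma>) = 1 / Gamma (x k) powr (\<gamma> - 1)"
      by (simp flip: powr_minus_divide)
    from split have 1: "s powr of_real \<beta> / s powr of_real (x k) = 1 / (s powr of_real \<alpha>) ^ k" using s0 by simp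
    have "- (s powr of_real \<beta>) * (of_real (Gamma (x k) powr (1 - \<gamma>)) / s powr of_real (x k) *
           (of_real (a k) * (of_real (Digamma (x k)) - ln s) + of_real (b k))) =
       (s powr of_real \<beta> / s powr of_real (x k)) * of_real (Gamma (x k) powr (1 - \<gamma>)) *
       (of_real (a k) * (ln s - of_real (Digamma (x k))) - of_real (b k))"
      by (simp add: diff_divide_distrib add_divide_distrib algebra_simps)
    also have "of_real (a k) * (ln s - of_real (Digamma (x k))) - of_real (b k) =
       of_real l ^ k * (of_real (\<omega> k) * (ln s + of_real ((\<gamma> - 1) * Digamma (x k))) + of_real (v * ln (Gamma (x k))))"
      by (simp add: a_def b_def algebra_simps)
    finally show "- (s powr of_real \<beta>) * (of_real (Gamma (x k) powr (1 - \<gamma>)) / s powr of_real (x k) *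
           (of_real (a k) * (of_real (Digamma (x k)) - ln s) + of_real (b k))) = c k"
      unfolding 1 c 2 by (simp add: x_def \<omega>_def power_divide)
  qed
  finally have S: "c sums (- (s powr of_real \<beta>) * laplace D s)" .
  moreover have "laplace D s = - (1 / s powr of_real \<beta>) * (- (s powr of_real \<beta>) * laplace D s)"
    using s0 by simp
  moreover have "\<forall>t>0. (\<lambda>q. K q t) field_differentiable at p"
    using K_deriv field_differentiable_def by blast
  ultimately show ?thesis using L(1) unfolding D_def by blast
qed

theorem theorem10:
  fixes \<alpha> \<beta> \<gamma> l :: real and s :: complex
  assumes "\<alpha> > 0" and "\<beta> > 0" and "\<gamma> > 1" and "Re s > 0"
  shows
    "((\<forall>t>0. (\<lambda>a. le_roy_kernel a \<beta> \<gamma> l t) field_differentiable at \<alpha>) \<and>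
      laplace_converges (\<lambda>t. deriv (\<lambda>a. le_roy_kernel a \<beta> \<gamma> l t) \<alpha>) s \<and>
      (\<exists>S. (\<lambda>k. of_nat k * (of_real l / s powr of_real \<alpha>) ^ k *
              ((ln s + of_real ((\<gamma> - 1) * Digamma (\<alpha> * real k + \<beta>)))
                / of_real (Gamma (\<alpha> * real k + \<beta>) powr (\<gamma> - 1)))) sums S \<and>
           laplace (\<lambda>t. deriv (\<lambda>a. le_roy_kernel a \<beta> \<gamma> l t) \<alpha>) s
             = - (1 / s powr of_real \<beta>) * S)) \<and>
     ((\<forall>t>0. (\<lambda>b. le_roy_kernel \<alpha> b \<gamma> l t) field_differentiable at \<beta>) \<and>
      laplace_converges (\<lambda>t. deriv (\<lambda>b. le_roy_kernel \<alpha> b \<gamma> l t) \<beta>) s \<and>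
      (\<exists>S. (\<lambda>k. (of_real l / s powr of_real \<alpha>) ^ k *
              ((ln s + of_real ((\<gamma> - 1) * Digamma (\<alpha> * real k + \<beta>)))
                / of_real (Gamma (\<alpha> * real k + \<beta>) powr (\<gamma> - 1)))) sums S \<and>
           laplace (\<lambda>t. deriv (\<lambda>b. le_roy_kernel \<alpha> b \<gamma> l t) \<beta>) s
             = - (1 / s powr of_real \<beta>) * S)) \<and>
     ((\<forall>t>0. (\<lambda>c. le_roy_kernel \<alpha> \<beta> c l t) field_differentiable at \<gamma>) \<and>
      laplace_converges (\<lambda>t. deriv (\<lambda>c. le_roy_kernel \<alpha> \<beta> c l t) \<gamma>) s \<and>
      (\<exists>S. (\<lambda>k. (of_real l / s powr of_real \<alpha>) ^ k *
              (of_real (ln (Gamma (\<alpha> * real k + \<beta>)))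
                / of_real (Gamma (\<alpha> * real k + \<beta>) powr (\<gamma> - 1)))) sums S \<and>
           laplace (\<lambda>t. deriv (\<lambda>c. le_roy_kernel \<alpha> \<beta> c l t) \<gamma>) s
             = - (1 / s powr of_real \<beta>) * S))"
proof (intro conjI[of "_ \<and> _ \<and> _"], goal_cases)
  case 1
  show ?case
    by (rule laplace_le_roy_directional[where u = 1 and w = 0 and v = 0 and l = l, OF assms])
       (simp_all add: mult_ac)
next
  case 2
  show ?case
    by (rule laplace_le_roy_directional[where u = 0 and w = 1 and v = 0 and l = l, OF assms]) simp_all
next
  case 3
  show ?case
    by (rule laplace_le_roy_directional[where u = 0 and w = 0 and v = 1 and l = l, OF assms]) simp_all
qed

end
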